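(* For all integers $n\ge 0$, $$H_{n,\lambda}^{Y}(x)=e^{-x}\sum_{k=0}^{\infty}\frac{E\big[\langle S_{k}\rangle_{n,\lambda}\big]}{k!}x^{k}.$$
   Context: Let $Y$ be a real random variable with $E[|Y|^{n}]<\infty$ for all integers $n\ge 0$ and $\lim_{n\to\infty}|t|^{n}E[|Y|^{n}]/n!=0$ for $|t|<r$, for some $r>0$. Let $Y_1,Y_2,\dots$ be i.i.d. copies of $Y$, $S_0=0$ and $S_k=Y_1+\cdots+Y_k$. Fix a nonzero real $\lambda$. Put $\langle x\rangle_{0,\lambda}=1$, $\langle x\rangle_{n,\lambda}=x(x+\lambda)\cdots(x+(n-1)\lambda)$, and $e_\lambda^{-Y}(-t)=(1-\lambda t)^{-Y/\lambda}$, so $E[e_\lambda^{-Y}(-t)]=\sum_{n\ge0}E[\langle Y\rangle_{n,\lambda}]t^n/n!$ near $t=0$. The probabilistic heterogeneous Bell polynomials $H^Y_{n,\lambda}(x)$ are defined by $e^{x(E[e_{\lambda}^{-Y}(-t)]-1)}=\sum_{n\ge0}H_{n,\lambda}^{Y}(x)t^{n}/n!$. *)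

theory Defs
  imports "HOL-Probability.Probability"
begin

definition rising_fact :: "real \<Rightarrow> real \<Rightarrow> nat \<Rightarrow> real" where
  "rising_fact lam x n = (\<Prod>i<n. x + real i * lam)"

text \<open>The degenerate exponential $e_\lambda^{x}(t) = (1 + \lambda t)^{x/\lambda}$; only used for
  $t$ near $0$, where the base is positive.\<close>

definition degen_exp :: "real \<Rightarrow> real \<Rightarrow> real \<Rightarrow> real" where
  "degen_exp lam x t = (1 + lam * t) powr (x / lam)"

text \<open>The generating function identity is required for all $t$ in some neighbourhood of $0$, which
  determines the coefficient sequence uniquely.\<close>

definition is_egf :: "(nat \<Rightarrow> real) \<Rightarrow> (real \<Rightarrow> real) \<Rightarrow> bool" where
  "is_egf a f \<longleftrightarrow> (\<forall>\<^sub>F t in nhds 0. (\<lambda>n. a n * t ^ n / fact n) sums f t)"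

definition het_bell :: "'a measure \<Rightarrow> ('a \<Rightarrow> real) \<Rightarrow> real \<Rightarrow> nat \<Rightarrow> real \<Rightarrow> real" where
  "het_bell M Y lam n x =
     (THE a. is_egf a (\<lambda>t. exp (x * ((\<integral>\<omega>. degen_exp lam (- Y \<omega>) (- t) \<partial>M) - 1)))) n"

end

theory Submission
  imports Defs "HOL-Complex_Analysis.Cauchy_Integral_Formula"
begin

text \<open>
  Let \<open>\<phi>(t)\<close> be the expectation of \<open>(1 - \<lambda>t) powr (- Y / \<lambda>)\<close>. For \<open>\<bar>t\<bar>\<close> small, the expectation of
  \<open>(1 - \<lambda>t) powr (- S\<^sub>k / \<lambda>)\<close> equals both \<open>\<phi>(t)\<^sup>k\<close>, by independence, and
  \<open>\<Sum>\<^sub>n E[\<langle>S\<^sub>k\<rangle>\<^sub>n] t\<^sup>n / n!\<close>, by the binomial series. Multiplying by \<open>x\<^sup>k / k!\<close>, summing over \<open>k\<close> and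
  exchanging the two sums gives \<open>exp (x \<phi>(t)) = \<Sum>\<^sub>n (\<Sum>\<^sub>k E[\<langle>S\<^sub>k\<rangle>\<^sub>n] x\<^sup>k / k!) t\<^sup>n / n!\<close>, and the claim follows
  by comparing coefficients. All exchanges are justified by the majorant
  \<open>\<Sum>\<^sub>n \<bar>\<langle>z\<rangle>\<^sub>n\<bar> T\<^sup>n / n! \<le> exp (c \<bar>z\<bar>)\<close> with \<open>T = (1 - exp (- c \<bar>\<lambda>\<bar>)) / \<bar>\<lambda>\<bar>\<close>, together with
  \<open>E[exp (c \<bar>S\<^sub>k\<bar>)] \<le> E[exp (c \<bar>Y\<bar>)]\<^sup>k < \<infinity>\<close> for \<open>c < r\<close>.
\<close>

section \<open>Uniqueness of the coefficients of a generating function\<close>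

lemma is_egf_unique:
  assumes "is_egf a f" and "is_egf b f"
  shows "a = b"
proof (rule ccontr)
  assume "a \<noteq> b"
  define d where "d n = (a n - b n) / fact n" for n
  obtain m where m: "d m \<noteq> 0"
    using \<open>a \<noteq> b\<close> by (auto simp: d_def fun_eq_iff)
  have "\<forall>\<^sub>F t in nhds 0. (\<lambda>n. d n * t ^ n) sums 0"
    using assms unfolding is_egf_def
  proof eventually_elim
    case (elim t)
    from sums_diff[OF this] show ?case
      by (simp add: d_def algebra_simps diff_divide_distrib)
  qed
  then obtain e where e: "e > 0" and d: "\<And>t. \<bar>t\<bar> < e \<Longrightarrow> (\<lambda>n. d n * t ^ n) sums 0"
    by (auto simp: eventually_nhds_metric dist_real_def)
  have "d 0 = 0"
    using sums_unique2[OF d[of 0] powser_sums_zero[of d]] e by simp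
  with m have "m > 0" by (metis gr0I)
  \<comment> \<open>Zeros are isolated: a power series with sum 0 at the origin and
    \<open>d m \<noteq> 0\<close> for some \<open>m > 0\<close> does not vanish on a punctured ball.
    Here the sum is constantly 0, so any point of that ball, such as \<open>s\<close>, gives a
    contradiction.\<close>
  from e obtain s where "s > 0" "\<And>z::real. z \<in> cball 0 s - {0} \<Longrightarrow> (0::real) \<noteq> 0"
    by (rule powser_0_nonzero[where a = d and \<xi> = 0 and f = "\<lambda>_. 0" and m = m])
       (use d m \<open>m > 0\<close> in auto)
  from this(2)[of s] \<open>s > 0\<close> show False by simp
qed

section \<open>Exchange of double series\<close>

text \<open>Fubini for series: the summable bound \<open>G\<close> on the absolute row sums makes
  the family absolutely summable over all pairs, so rows and columns may be summed in either order.
  Convergence of the columns is a conclusion of its own because the theorem also asserts it.\<close>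

lemma sums_swap_dominated:
  fixes f :: "nat \<Rightarrow> nat \<Rightarrow> real"
  assumes abs: "\<And>k. summable (\<lambda>n. \<bar>f k n\<bar>)"
    and le: "\<And>k. (\<Sum>n. \<bar>f k n\<bar>) \<le> G k" and G: "summable G"
    and g: "\<And>k. f k sums g k" and s: "g sums s"
  shows "summable (\<lambda>k. f k n)" and "(\<lambda>n. \<Sum>k. f k n) sums s"
proof -
  define h where "h k = (\<Sum>n. \<bar>f k n\<bar>)" for k
  have h_nonneg: "h k \<ge> 0" for k
    unfolding h_def by (rule suminf_nonneg[OF abs]) auto
  have h: "summable h"
    using le h_nonneg by (intro summable_comparison_test'[OF G, of 0]) (auto simp: h_def)
  have "(\<lambda>p. \<bar>case_prod f p\<bar>) summable_on (UNIV \<times> UNIV)"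
  proof (rule summable_on_SigmaI)
    show "((\<lambda>y. \<bar>case_prod f (k, y)\<bar>) has_sum h k) UNIV" for k
      using summable_sums[OF abs[of k]] abs
      by (intro norm_summable_imp_has_sum) (auto simp: h_def)
    show "h summable_on UNIV"
      using h h_nonneg by (subst summable_on_UNIV_nonneg_real_iff) auto
  qed auto
  then have sm: "case_prod f summable_on (UNIV \<times> UNIV)"
    by (subst summable_on_iff_abs_summable_on_real) simp
  have g_le: "\<bar>g k\<bar> \<le> h k" for k
    unfolding h_def using summable_rabs[OF abs[of k]] sums_unique[OF g[of k]] by simp
  have "(g has_sum s) UNIV"
    by (rule norm_summable_imp_has_sum[OF _ s])
       (use g_le in \<open>intro summable_comparison_test'[OF h, of 0], auto\<close>)
  then have "(case_prod f has_sum s) (UNIV \<times> UNIV)"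
    by (intro has_sum_SigmaI[OF _ _ sm, where g = g])
       (auto intro!: norm_summable_imp_has_sum abs g)
  \<comment> \<open>Unordered sums over pairs are invariant under exchanging coordinates; the rest
    reads the result back as an iterated ordered sum.\<close>
  then have sw: "((\<lambda>(n, k). f k n) has_sum s) (UNIV \<times> UNIV)"
    by (subst (asm) has_sum_swap) (simp add: case_prod_unfold)
  then have "(\<lambda>(n, k). f k n) summable_on (UNIV \<times> UNIV)"
    by (auto simp: summable_on_def)
  from summable_on_SigmaD1[OF this] have col: "(\<lambda>k. f k n) summable_on UNIV" for n
    by simp
  then show "summable (\<lambda>k. f k n)" for n
    by (rule summable_on_imp_summable)
  have "((\<lambda>n. \<Sum>k. f k n) has_sum s) UNIV"
  proof (rule has_sum_SigmaD[OF sw])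
    fix n
    from col[of n] obtain c where c: "((\<lambda>k. f k n) has_sum c) UNIV"
      by (auto simp: summable_on_def)
    with sums_unique[OF has_sum_imp_sums[OF c]]
    show "((\<lambda>k. case (n, k) of (n, k) \<Rightarrow> f k n) has_sum (\<Sum>k. f k n)) UNIV" by simp
  qed
  then show "(\<lambda>n. \<Sum>k. f k n) sums s"
    by (rule has_sum_imp_sums)
qed

section \<open>Rising factorials and their exponential majorant\<close>

text \<open>This is Newton's binomial series with exponent \<open>- z / lam\<close> at
  \<open>- lam * t\<close>: each factor \<open>- z / lam - i\<close> times \<open>- lam * t\<close>
  equals \<open>(z + i * lam) * t\<close>.\<close>

lemma rising_fact_sums:
  assumes "lam \<noteq> 0" and "\<bar>lam * t\<bar> < 1"
  shows "(\<lambda>n. rising_fact lam z n * t ^ n / fact n) sums degen_exp lam (- z) (- t)"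
proof -
  have "((- z / lam) gchoose n) * (- (lam * t)) ^ n = rising_fact lam z n * t ^ n / fact n" for n
  proof -
    have "(\<Prod>i<n. - z / lam - real i) * (- (lam * t)) ^ n
        = (\<Prod>i<n. (- z / lam - real i) * (- (lam * t)))"
      by (simp only: prod.distrib prod_constant card_lessThan)
    also have "\<dots> = (\<Prod>i<n. (z + real i * lam) * t)"
      using assms(1) by (intro prod.cong) (auto simp: field_simps)
    also have "\<dots> = rising_fact lam z n * t ^ n"
      by (simp only: rising_fact_def prod.distrib prod_constant card_lessThan)
    finally show ?thesis
      by (simp add: gbinomial_prod_rev atLeast0LessThan)
  qed
  with gen_binomial_real[of "- (lam * t)" "- z / lam"] assms(2) show ?thesis
    by (simp add: degen_exp_def)
qed

lemma abs_rising_fact_le: "\<bar>rising_fact lam z n\<bar> \<le> rising_fact \<bar>lam\<bar> \<bar>z\<bar> n"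
  unfolding rising_fact_def abs_prod
  by (rule prod_mono) (auto simp: abs_mult intro: order_trans[OF abs_triangle_ineq])

lemma rising_fact_nonneg: "lam \<ge> 0 \<Longrightarrow> z \<ge> 0 \<Longrightarrow> rising_fact lam z n \<ge> 0"
  unfolding rising_fact_def by (intro prod_nonneg) auto

lemma borel_measurable_rising_fact [measurable]:
  "(\<lambda>z. rising_fact lam z n) \<in> borel_measurable borel"
  unfolding rising_fact_def by measurable

text \<open>The solution \<open>T\<close> of \<open>(1 - \<bar>lam\<bar> * T) powr (- 1 /
  \<bar>lam\<bar>) = exp c\<close>, chosen so that the binomial series at \<open>T\<close> sums to
  exactly \<open>exp (c * z)\<close>.\<close>

definition majorant_radius :: "real \<Rightarrow> real \<Rightarrow> real" where
  "majorant_radius lam c = (1 - exp (- c * \<bar>lam\<bar>)) / \<bar>lam\<bar>"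

lemma majorant_radius_pos: "lam \<noteq> 0 \<Longrightarrow> c > 0 \<Longrightarrow> majorant_radius lam c > 0"
  by (simp add: majorant_radius_def)

lemma majorant_radius_less: "lam \<noteq> 0 \<Longrightarrow> \<bar>lam\<bar> * majorant_radius lam c < 1"
  by (simp add: majorant_radius_def)

lemma rising_fact_majorant_sums:
  assumes "lam \<noteq> 0" and "c > 0"
  shows "(\<lambda>n. rising_fact \<bar>lam\<bar> z n * majorant_radius lam c ^ n / fact n) sums exp (c * z)"
proof -
  have "\<bar>\<bar>lam\<bar> * majorant_radius lam c\<bar> < 1"
    using majorant_radius_pos[OF assms] majorant_radius_less[OF assms(1), of c]
    by (simp add: abs_mult)
  moreover have "1 - \<bar>lam\<bar> * majorant_radius lam c = exp (- c * \<bar>lam\<bar>)"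
    using assms(1) by (simp add: majorant_radius_def)
  ultimately show ?thesis
    using rising_fact_sums[of "\<bar>lam\<bar>" "majorant_radius lam c" z] assms(1)
    by (simp add: degen_exp_def powr_def mult.commute)
qed

text \<open>Replacing \<open>lam\<close> and \<open>z\<close> by their absolute values makes all
  terms nonnegative, so partial sums stay below the full series. The finite form serves both to
  bound single terms and to prove convergence.\<close>

lemma sum_abs_rising_fact_le_exp:
  assumes "lam \<noteq> 0" and "c > 0"
  shows "(\<Sum>n<m. \<bar>rising_fact lam z n\<bar> * majorant_radius lam c ^ n / fact n) \<le> exp (c * \<bar>z\<bar>)"
proof -
  let ?T = "majorant_radius lam c"
  have T: "?T > 0" using majorant_radius_pos[OF assms] .
  note sums = rising_fact_majorant_sums[OF assms, of "\<bar>z\<bar>"]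
  have "(\<Sum>n<m. \<bar>rising_fact lam z n\<bar> * ?T ^ n / fact n)
      \<le> (\<Sum>n<m. rising_fact \<bar>lam\<bar> \<bar>z\<bar> n * ?T ^ n / fact n)"
    using T by (intro sum_mono divide_right_mono mult_right_mono abs_rising_fact_le) auto
  also have "\<dots> \<le> (\<Sum>n. rising_fact \<bar>lam\<bar> \<bar>z\<bar> n * ?T ^ n / fact n)"
    using T by (intro sum_le_suminf sums_summable[OF sums])
      (auto intro!: divide_nonneg_nonneg mult_nonneg_nonneg rising_fact_nonneg)
  also have "\<dots> = exp (c * \<bar>z\<bar>)"
    using sums_unique[OF sums] by simp
  finally show ?thesis .
qed

section \<open>Expectations of rising factorials under an exponential moment\<close>

text \<open>The facts below are applied with \<open>Z\<close> equal to \<open>Y\<close> on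
  \<open>M\<close> and to \<open>S k\<close> on \<open>N\<close>.\<close>

context
  fixes M :: "'a measure" and Z :: "'a \<Rightarrow> real" and lam c :: real
  assumes Z [measurable]: "Z \<in> borel_measurable M"
    and lam: "lam \<noteq> 0" and c: "c > 0"
    and int_exp: "integrable M (\<lambda>\<omega>. exp (c * \<bar>Z \<omega>\<bar>))"
begin

lemma integrable_rising_fact: "integrable M (\<lambda>\<omega>. rising_fact lam (Z \<omega>) n)"
proof -
  let ?T = "majorant_radius lam c"
  have T: "?T > 0" using majorant_radius_pos[OF lam c] .
  have le: "\<bar>rising_fact lam z n\<bar> \<le> fact n / ?T ^ n * exp (c * \<bar>z\<bar>)" for z
  proof -
    \<comment> \<open>A single term of the nonnegative sum is at most the whole sum.\<close>
    have "\<bar>rising_fact lam z n\<bar> * ?T ^ n / fact n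
        \<le> (\<Sum>n<Suc n. \<bar>rising_fact lam z n\<bar> * ?T ^ n / fact n)"
      using T by (intro member_le_sum) auto
    also have "\<dots> \<le> exp (c * \<bar>z\<bar>)"
      by (rule sum_abs_rising_fact_le_exp[OF lam c])
    finally show ?thesis
      using T by (simp add: field_simps)
  qed
  show ?thesis
    by (rule Bochner_Integration.integrable_bound[OF integrable_mult_right[OF int_exp, of "fact n / ?T ^ n"]])
       (use le T in \<open>auto simp: abs_mult\<close>)
qed

text \<open>Finite sums commute with the integral, so the pointwise majorant bounds all partial sums
  uniformly; the terms are nonnegative.\<close>

lemma
  shows summable_expectation_rising_fact:
      "summable (\<lambda>n. (\<integral>\<omega>. \<bar>rising_fact lam (Z \<omega>) n\<bar> \<partial>M) * majorant_radius lam c ^ n / fact n)"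
    and suminf_expectation_rising_fact_le:
      "(\<Sum>n. (\<integral>\<omega>. \<bar>rising_fact lam (Z \<omega>) n\<bar> \<partial>M) * majorant_radius lam c ^ n / fact n)
        \<le> (\<integral>\<omega>. exp (c * \<bar>Z \<omega>\<bar>) \<partial>M)"
proof -
  let ?T = "majorant_radius lam c"
  have T: "?T > 0" using majorant_radius_pos[OF lam c] .
  have int: "integrable M (\<lambda>\<omega>. \<bar>rising_fact lam (Z \<omega>) n\<bar>)" for n
    using integrable_rising_fact by (rule integrable_abs)
  have le: "(\<Sum>n<m. (\<integral>\<omega>. \<bar>rising_fact lam (Z \<omega>) n\<bar> \<partial>M) * ?T ^ n / fact n)
      \<le> (\<integral>\<omega>. exp (c * \<bar>Z \<omega>\<bar>) \<partial>M)" for m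
  proof -
    have "(\<Sum>n<m. (\<integral>\<omega>. \<bar>rising_fact lam (Z \<omega>) n\<bar> \<partial>M) * ?T ^ n / fact n)
        = (\<integral>\<omega>. (\<Sum>n<m. \<bar>rising_fact lam (Z \<omega>) n\<bar> * ?T ^ n / fact n) \<partial>M)"
      using int by (subst Bochner_Integration.integral_sum) auto
    also have "\<dots> \<le> (\<integral>\<omega>. exp (c * \<bar>Z \<omega>\<bar>) \<partial>M)"
      using int sum_abs_rising_fact_le_exp[OF lam c]
      by (intro integral_mono int_exp Bochner_Integration.integrable_sum) auto
    finally show ?thesis .
  qed
  show sm: "summable (\<lambda>n. (\<integral>\<omega>. \<bar>rising_fact lam (Z \<omega>) n\<bar> \<partial>M) * ?T ^ n / fact n)"
    by (rule summableI_nonneg_bounded[OF _ le]) (use T in auto)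
  show "(\<Sum>n. (\<integral>\<omega>. \<bar>rising_fact lam (Z \<omega>) n\<bar> \<partial>M) * ?T ^ n / fact n)
      \<le> (\<integral>\<omega>. exp (c * \<bar>Z \<omega>\<bar>) \<partial>M)"
    by (rule suminf_le_const[OF sm le])
qed

text \<open>The binomial series may be integrated term by term because the integrals of the absolute
  values of its terms form a convergent series.\<close>

lemma expectation_rising_fact_sums:
  assumes t: "\<bar>t\<bar> \<le> majorant_radius lam c"
  shows "(\<lambda>n. (\<integral>\<omega>. rising_fact lam (Z \<omega>) n \<partial>M) * t ^ n / fact n)
    sums (\<integral>\<omega>. degen_exp lam (- Z \<omega>) (- t) \<partial>M)"
    and "integrable M (\<lambda>\<omega>. degen_exp lam (- Z \<omega>) (- t))"
proof -
  let ?T = "majorant_radius lam c"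
  let ?f = "\<lambda>n \<omega>. rising_fact lam (Z \<omega>) n * t ^ n / fact n"
  have T: "?T > 0" using majorant_radius_pos[OF lam c] .
  have "\<bar>lam * t\<bar> \<le> \<bar>lam\<bar> * ?T"
    using t by (auto simp: abs_mult intro: mult_left_mono)
  then have lt: "\<bar>lam * t\<bar> < 1"
    using majorant_radius_less[OF lam, of c] by linarith
  have pow: "\<bar>t\<bar> ^ n \<le> ?T ^ n" for n
    using t by (intro power_mono) auto
  have int: "integrable M (?f n)" for n
    using integrable_rising_fact by auto
  have "summable (\<lambda>n. norm (?f n \<omega>))" for \<omega>
  proof (rule summableI_nonneg_bounded)
    fix m
    have "(\<Sum>n<m. norm (?f n \<omega>)) \<le> (\<Sum>n<m. \<bar>rising_fact lam (Z \<omega>) n\<bar> * ?T ^ n / fact n)"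
      by (intro sum_mono) (auto simp: abs_mult power_abs intro!: divide_right_mono mult_left_mono pow)
    also have "\<dots> \<le> exp (c * \<bar>Z \<omega>\<bar>)"
      by (rule sum_abs_rising_fact_le_exp[OF lam c])
    finally show "(\<Sum>n<m. norm (?f n \<omega>)) \<le> exp (c * \<bar>Z \<omega>\<bar>)" .
  qed auto
  then have ae: "AE \<omega> in M. summable (\<lambda>n. norm (?f n \<omega>))"
    by auto
  have norm: "(\<integral>\<omega>. norm (?f n \<omega>) \<partial>M)
      = (\<integral>\<omega>. \<bar>rising_fact lam (Z \<omega>) n\<bar> \<partial>M) * \<bar>t\<bar> ^ n / fact n" for n
    by (simp add: abs_mult power_abs)
  have sm: "summable (\<lambda>n. (\<integral>\<omega>. norm (?f n \<omega>) \<partial>M))"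
    unfolding norm
    by (rule summable_comparison_test'[OF summable_expectation_rising_fact, of 0])
       (auto simp: abs_mult intro!: divide_right_mono mult_left_mono pow)
  have eq: "(\<Sum>n. ?f n \<omega>) = degen_exp lam (- Z \<omega>) (- t)" for \<omega>
    using rising_fact_sums[OF lam lt] by (rule sums_unique[symmetric])
  show "(\<lambda>n. (\<integral>\<omega>. rising_fact lam (Z \<omega>) n \<partial>M) * t ^ n / fact n)
    sums (\<integral>\<omega>. degen_exp lam (- Z \<omega>) (- t) \<partial>M)"
    using sums_integral[OF int ae sm] by (simp add: eq)
  show "integrable M (\<lambda>\<omega>. degen_exp lam (- Z \<omega>) (- t))"
    using integrable_suminf[OF int ae sm] by (simp add: eq)
qed

end

text \<open>The sequence in \<open>lim\<close> is bounded by some \<open>B\<close>, so the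
  integrated terms of the exponential series at \<open>c < q\<close> are dominated by the geometric
  series \<open>B * (c / q) ^ m\<close>.\<close>

lemma integrable_exp_abs:
  fixes Y :: "'a \<Rightarrow> real"
  assumes [measurable]: "Y \<in> borel_measurable M"
    and int: "\<And>m. integrable M (\<lambda>\<omega>. \<bar>Y \<omega>\<bar> ^ m)"
    and lim: "(\<lambda>m. q ^ m * (\<integral>\<omega>. \<bar>Y \<omega>\<bar> ^ m \<partial>M) / fact m) \<longlonglongrightarrow> 0"
    and "0 < c" and "c < q"
  shows "integrable M (\<lambda>\<omega>. exp (c * \<bar>Y \<omega>\<bar>))"
proof -
  let ?E = "\<lambda>m. \<integral>\<omega>. \<bar>Y \<omega>\<bar> ^ m \<partial>M"
  let ?f = "\<lambda>m \<omega>. (c * \<bar>Y \<omega>\<bar>) ^ m / fact m"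
  obtain B where B: "\<And>m. \<bar>q ^ m * ?E m / fact m\<bar> \<le> B"
    using convergent_imp_Bseq[OF convergentI[OF lim]] by (auto simp: Bseq_def)
  have q: "q > 0" using assms by simp
  have norm: "(\<integral>\<omega>. norm (?f m \<omega>) \<partial>M) = c ^ m * ?E m / fact m" for m
    using assms by (simp add: power_mult_distrib abs_mult)
  have "summable (\<lambda>m. c ^ m * ?E m / fact m)"
  proof (rule summable_comparison_test'[of "\<lambda>m. B * (c / q) ^ m" 0])
    show "summable (\<lambda>m. B * (c / q) ^ m)"
      using assms q by (intro summable_mult summable_geometric) auto
    fix m
    have "c ^ m * ?E m / fact m = (q ^ m * ?E m / fact m) * (c / q) ^ m"
      using q by (simp add: power_divide)
    then have "norm (c ^ m * ?E m / fact m) = \<bar>q ^ m * ?E m / fact m\<bar> * (c / q) ^ m"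
      using q assms by (simp add: abs_mult)
    also have "\<dots> \<le> B * (c / q) ^ m"
      using B q assms by (intro mult_right_mono) auto
    finally show "norm (c ^ m * ?E m / fact m) \<le> B * (c / q) ^ m" .
  qed
  then have sm: "summable (\<lambda>m. (\<integral>\<omega>. norm (?f m \<omega>) \<partial>M))"
    by (simp only: norm)
  have exp: "?f m \<omega> = (c * \<bar>Y \<omega>\<bar>) ^ m /\<^sub>R fact m" for m \<omega>
    by (simp add: field_simps)
  have "integrable M (\<lambda>\<omega>. \<Sum>m. ?f m \<omega>)"
  proof (rule integrable_suminf[OF _ _ sm])
    show "integrable M (?f m)" for m
      using int by (simp add: power_mult_distrib)
    show "AE \<omega> in M. summable (\<lambda>m. norm (?f m \<omega>))"
      unfolding exp by (intro AE_I2 summable_norm_exp)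
  qed
  then show ?thesis
    unfolding exp by (simp add: exp_def)
qed

section \<open>Expectations of \<open>S k\<close>, summation over \<open>k\<close> and comparison of
  coefficients\<close>

theorem theorem2p6:
  fixes M :: "'a measure" and N :: "'b measure"
    and Y :: "'a \<Rightarrow> real" and Ys :: "nat \<Rightarrow> 'b \<Rightarrow> real"
    and S :: "nat \<Rightarrow> 'b \<Rightarrow> real"
    and lam r x :: real and n :: nat
  assumes "prob_space M" and "prob_space N"
    and "Y \<in> borel_measurable M"
    and "\<And>m. integrable M (\<lambda>\<omega>. \<bar>Y \<omega>\<bar> ^ m)"
    and "r > 0"
    and "\<And>t. \<bar>t\<bar> < r \<Longrightarrow>
           (\<lambda>m. \<bar>t\<bar> ^ m * (\<integral>\<omega>. \<bar>Y \<omega>\<bar> ^ m \<partial>M) / fact m) \<longlonglongrightarrow> 0"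
    and "prob_space.indep_vars N (\<lambda>_. borel) Ys {1..}"
    and "\<And>i. i \<ge> 1 \<Longrightarrow> distr N borel (Ys i) = distr M borel Y"
    and "\<And>k \<omega>. S k \<omega> = (\<Sum>i=1..k. Ys i \<omega>)"
    and "lam \<noteq> 0"
  shows "summable (\<lambda>k. (\<integral>\<omega>. rising_fact lam (S k \<omega>) n \<partial>N) / fact k * x ^ k) \<and>
         het_bell M Y lam n x =
           exp (- x) * (\<Sum>k. (\<integral>\<omega>. rising_fact lam (S k \<omega>) n \<partial>N) / fact k * x ^ k)"
proof -
  interpret N: prob_space N by fact
  note [measurable] = assms(3)
  note S = assms(9) and lam = assms(10)
  define c where "c = r / 2"
  have c: "c > 0" using assms(5) by (simp add: c_def)
  let ?T = "majorant_radius lam c"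
  have T: "?T > 0" using majorant_radius_pos[OF lam c] .
  \<comment> \<open>The moment condition is used at \<open>3 * r / 4\<close>, strictly between
    \<open>c = r / 2\<close> and \<open>r\<close>.\<close>
  have intY: "integrable M (\<lambda>\<omega>. exp (c * \<bar>Y \<omega>\<bar>))"
    by (rule integrable_exp_abs[of _ _ "3 * r / 4"])
       (use assms(3-5) assms(6)[of "3 * r / 4"] in \<open>auto simp: c_def\<close>)
  define A where "A = (\<integral>\<omega>. exp (c * \<bar>Y \<omega>\<bar>) \<partial>M)"
  define \<phi> where "\<phi> t = (\<integral>\<omega>. degen_exp lam (- Y \<omega>) (- t) \<partial>M)" for t
  have Ys [measurable]: "Ys i \<in> borel_measurable N" if "i \<ge> 1" for i
    using assms(7) that by (auto simp: N.indep_vars_def)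

  \<comment> \<open>Independence factors the expectation and equality in law identifies the factors.
    Used for \<open>exp (c * \<bar>y\<bar>)\<close>, to bound moments of \<open>S k\<close>, and for
    the degenerate exponential, to get \<open>\<phi> t ^ k\<close>.\<close>
  have iid: "(\<integral>\<omega>. (\<Prod>i=1..k. g (Ys i \<omega>)) \<partial>N) = (\<integral>\<omega>. g (Y \<omega>) \<partial>M) ^ k"
    "integrable N (\<lambda>\<omega>. \<Prod>i=1..k. g (Ys i \<omega>))"
    if g [measurable]: "g \<in> borel_measurable borel" and int: "integrable M (\<lambda>\<omega>. g (Y \<omega>))"
    for g :: "real \<Rightarrow> real" and k
  proof -
    have ind: "N.indep_vars (\<lambda>_. borel) (\<lambda>i \<omega>. g (Ys i \<omega>)) {1..k}"
      by (rule N.indep_vars_compose2[OF N.indep_vars_subset[OF assms(7)]]) auto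
    have intYs: "integrable N (\<lambda>\<omega>. g (Ys i \<omega>))" if "i \<in> {1..k}" for i
      using int that Ys[of i] assms(8)[of i]
      by (metis assms(3) atLeastAtMost_iff g integrable_distr_eq)
    have "(\<integral>\<omega>. g (Ys i \<omega>) \<partial>N) = (\<integral>\<omega>. g (Y \<omega>) \<partial>M)" if "i \<in> {1..k}" for i
      using that Ys[of i] assms(8)[of i]
      by (metis assms(3) atLeastAtMost_iff g integral_distr)
    then show "(\<integral>\<omega>. (\<Prod>i=1..k. g (Ys i \<omega>)) \<partial>N) = (\<integral>\<omega>. g (Y \<omega>) \<partial>M) ^ k"
      using N.indep_vars_lebesgue_integral[OF _ ind intYs] by simp
    show "integrable N (\<lambda>\<omega>. \<Prod>i=1..k. g (Ys i \<omega>))"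
      using N.indep_vars_integrable[OF _ ind intYs] by simp
  qed

  have S_meas [measurable]: "S k \<in> borel_measurable N" for k
    unfolding S[abs_def] by (intro borel_measurable_sum Ys) auto
  have exp_le: "exp (c * \<bar>S k \<omega>\<bar>) \<le> (\<Prod>i=1..k. exp (c * \<bar>Ys i \<omega>\<bar>))" for k \<omega>
  proof -
    have "c * \<bar>S k \<omega>\<bar> \<le> c * (\<Sum>i=1..k. \<bar>Ys i \<omega>\<bar>)"
      unfolding S using c by (intro mult_left_mono sum_abs) auto
    then show ?thesis
      by (simp add: exp_sum[symmetric] sum_distrib_left)
  qed
  have prodE: "integrable N (\<lambda>\<omega>. \<Prod>i=1..k. exp (c * \<bar>Ys i \<omega>\<bar>))"
    "(\<integral>\<omega>. (\<Prod>i=1..k. exp (c * \<bar>Ys i \<omega>\<bar>)) \<partial>N) = A ^ k" for k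
    using iid[of "\<lambda>y. exp (c * \<bar>y\<bar>)" k] intY by (auto simp: A_def)
  have intS: "integrable N (\<lambda>\<omega>. exp (c * \<bar>S k \<omega>\<bar>))" for k
    by (rule Bochner_Integration.integrable_bound[OF prodE(1)[of k]])
       (use exp_le in \<open>auto intro: order_trans[OF _ abs_ge_self]\<close>)
  have ES_le: "(\<integral>\<omega>. exp (c * \<bar>S k \<omega>\<bar>) \<partial>N) \<le> A ^ k" for k
    unfolding prodE(2)[symmetric] by (rule integral_mono[OF intS prodE(1) exp_le])
  have ES: "(\<integral>\<omega>. degen_exp lam (- S k \<omega>) (- t) \<partial>N) = \<phi> t ^ k" if t: "\<bar>t\<bar> \<le> ?T" for k t
  proof -
    have "\<bar>lam * t\<bar> \<le> \<bar>lam\<bar> * ?T"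
      using t by (auto simp: abs_mult intro: mult_left_mono)
    \<comment> \<open>Since \<open>0 powr 0 = 0\<close>, turning the power of a sum into a product
      would fail at base 0 for the empty sum \<open>k = 0\<close>.\<close>
    then have ne: "1 + lam * - t \<noteq> 0"
      using majorant_radius_less[OF lam, of c] by auto
    have "degen_exp lam (- S k \<omega>) (- t) = (\<Prod>i=1..k. degen_exp lam (- Ys i \<omega>) (- t))" for \<omega>
      unfolding degen_exp_def S powr_sum[OF ne, symmetric]
      by (simp add: sum_negf sum_divide_distrib)
    then show ?thesis
      using iid(1)[of "\<lambda>y. degen_exp lam (- y) (- t)" k]
        expectation_rising_fact_sums(2)[OF assms(3) lam c intY t]
      by (simp add: \<phi>_def degen_exp_def)
  qed

  let ?b = "\<lambda>k n. \<integral>\<omega>. rising_fact lam (S k \<omega>) n \<partial>N"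
  let ?f = "\<lambda>t k n. x ^ k / fact k * (?b k n * t ^ n / fact n)"
  have swap: "summable (\<lambda>k. ?f t k n)" "(\<lambda>n. \<Sum>k. ?f t k n) sums exp (x * \<phi> t)"
    if t: "\<bar>t\<bar> \<le> ?T" for t n
  proof -
    have le: "\<bar>?b k n * t ^ n / fact n\<bar> \<le> (\<integral>\<omega>. \<bar>rising_fact lam (S k \<omega>) n\<bar> \<partial>N) * ?T ^ n / fact n"
      for k n
      using t T unfolding abs_mult abs_divide power_abs
      by (auto intro!: divide_right_mono mult_mono power_mono integral_abs_bound)
    note smE = summable_expectation_rising_fact[OF S_meas lam c intS]
    have abs1: "summable (\<lambda>n. \<bar>?b k n * t ^ n / fact n\<bar>)" for k
      by (rule summable_comparison_test'[OF smE[of k], of 0]) (use le in simp)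
    have le1: "(\<Sum>n. \<bar>?b k n * t ^ n / fact n\<bar>) \<le> A ^ k" for k
      using suminf_le[OF le abs1 smE, of k]
        suminf_expectation_rising_fact_le[OF S_meas lam c intS, of k] ES_le[of k] by linarith
    have abs: "\<bar>?f t k n\<bar> = \<bar>x ^ k / fact k\<bar> * \<bar>?b k n * t ^ n / fact n\<bar>" for k n
      by (rule abs_mult)
    have 1: "summable (\<lambda>n. \<bar>?f t k n\<bar>)" for k
      unfolding abs by (rule summable_mult[OF abs1])
    \<comment> \<open>The dominating row bounds are the terms of the series for
      \<open>exp (\<bar>x\<bar> * A)\<close>.\<close>
    have 2: "(\<Sum>n. \<bar>?f t k n\<bar>) \<le> (\<bar>x\<bar> * A) ^ k /\<^sub>R fact k" for k
    proof -
      have "(\<Sum>n. \<bar>?f t k n\<bar>) = \<bar>x ^ k / fact k\<bar> * (\<Sum>n. \<bar>?b k n * t ^ n / fact n\<bar>)"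
        unfolding abs by (rule suminf_mult[OF abs1])
      also have "\<dots> \<le> \<bar>x ^ k / fact k\<bar> * A ^ k"
        by (rule mult_left_mono[OF le1]) simp
      finally show ?thesis
        by (simp add: power_mult_distrib power_abs field_simps)
    qed
    have 3: "summable (\<lambda>k. (\<bar>x\<bar> * A) ^ k /\<^sub>R fact k)"
      by (rule summable_exp_generic)
    have 4: "?f t k sums (x ^ k / fact k * \<phi> t ^ k)" for k
      using sums_mult[OF expectation_rising_fact_sums(1)[OF S_meas lam c intS t], of "x ^ k / fact k"]
      by (simp only: ES[OF t])
    have 5: "(\<lambda>k. x ^ k / fact k * \<phi> t ^ k) sums exp (x * \<phi> t)"
      using exp_converges[of "x * \<phi> t"] by (simp add: power_mult_distrib field_simps)
    show "summable (\<lambda>k. ?f t k n)" "(\<lambda>n. \<Sum>k. ?f t k n) sums exp (x * \<phi> t)"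
      using sums_swap_dominated[OF 1 2 3 4 5] by blast+
  qed

  have sm: "summable (\<lambda>k. ?b k n / fact k * x ^ k)" for n
  proof -
    \<comment> \<open>At the nonzero point \<open>t = ?T\<close> the factor
      \<open>t ^ n / fact n\<close> can be cancelled from the column.\<close>
    have "summable (\<lambda>k. ?f ?T k n * (fact n / ?T ^ n))"
      using swap(1)[of ?T n] T by (intro summable_mult2) auto
    then show ?thesis
      using T by (simp add: mult_ac)
  qed
  define a where "a n = exp (- x) * (\<Sum>k. ?b k n / fact k * x ^ k)" for n
  have sums_a: "(\<lambda>n. a n * t ^ n / fact n) sums exp (x * (\<phi> t - 1))" if t: "\<bar>t\<bar> \<le> ?T" for t
  proof -
    have "(\<Sum>k. ?f t k n) = (\<Sum>k. ?b k n / fact k * x ^ k) * (t ^ n / fact n)" for n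
      by (subst suminf_mult2[OF sm]) (simp add: mult_ac)
    then have "exp (- x) * (\<Sum>k. ?f t k n) = a n * t ^ n / fact n" for n
      by (simp add: a_def)
    \<comment> \<open>The factor \<open>exp (- x)\<close> turns \<open>exp (x * \<phi> t)\<close>
      into \<open>exp (x * (\<phi> t - 1))\<close>.\<close>
    with sums_mult[OF swap(2)[OF t], of "exp (- x)"] show ?thesis
      by (simp add: exp_add[symmetric] algebra_simps)
  qed
  have "is_egf a (\<lambda>t. exp (x * (\<phi> t - 1)))"
    unfolding is_egf_def eventually_nhds_metric
    by (rule exI[of _ ?T]) (use T sums_a in \<open>auto simp: dist_real_def\<close>)
  then have "(THE a. is_egf a (\<lambda>t. exp (x * (\<phi> t - 1)))) = a"
    by (intro the_equality) (auto intro: is_egf_unique)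
  then have "het_bell M Y lam n x = a n"
    by (simp add: het_bell_def \<phi>_def)
  with sm show ?thesis
    by (simp add: a_def)
qed

end
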